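(* Let $f : \mathbb{N} \to \mathbb{Z}$ be a function such that for some $t \in \mathbb{N}$ we have $|f(n)| \leq n^t$ for all $n \geq n(t)$. Define, for integers $n$, $$A_f(n) := \#\{(x,y) \in \mathbb{N}\times\mathbb{N} : f(x) + f(y) = n\}, \qquad \tilde A_f(n) := \#\{(x,y) \in \mathbb{N}\times\mathbb{N} : f(x) - f(y) = n\}.$$ Assume that either $A_f(n) = O(|n|^{\varepsilon})$ as $|n| \to \infty$ for every $\varepsilon > 0$, or $\tilde A_f(n) = O(|n|^{\varepsilon})$ as $n \to \infty$ for every $\varepsilon>0$. Then for almost all $\alpha \in \mathbb{R}$ the discrepancy $D_N$ of $(\{f(n)\alpha\})_{n\geq 1}$ satisfies: for every $\varepsilon > 0$ there are infinitely many $N$ with $$N D_N \geq N^{\frac12 - \varepsilon}.$$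
   Context: For real $x$, $\{x\}$ denotes the fractional part of $x$. For a sequence $(x_n)_{n\ge1}$ in $[0,1)$, its discrepancy is $$D_N = \sup_{0 \leq a < b \leq 1} \left| \frac{A_N([a,b))}{N} - (b-a) \right|, \qquad A_N([a,b)) = \#\{1 \leq n \leq N : x_n \in [a,b)\}.$$ *)

theory Defs
  imports "HOL-Analysis.Analysis"
begin

text \<open>Convention: \<open>\<nat>\<close> = positive integers {1,2,...}; values of f at 0 are irrelevant.\<close>

definition sum_reps :: "(nat \<Rightarrow> int) \<Rightarrow> int \<Rightarrow> (nat \<times> nat) set" where
  "sum_reps f n = {(x, y). x \<ge> 1 \<and> y \<ge> 1 \<and> f x + f y = n}"

definition diff_reps :: "(nat \<Rightarrow> int) \<Rightarrow> int \<Rightarrow> (nat \<times> nat) set" where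
  "diff_reps f n = {(x, y). x \<ge> 1 \<and> y \<ge> 1 \<and> f x - f y = n}"

definition sum_reps_small :: "(nat \<Rightarrow> int) \<Rightarrow> bool" where
  "sum_reps_small f \<longleftrightarrow> (\<forall>\<epsilon>>0. \<exists>C n0. \<forall>n::int. \<bar>n\<bar> \<ge> n0 \<longrightarrow>
      finite (sum_reps f n) \<and> real (card (sum_reps f n)) \<le> C * real_of_int \<bar>n\<bar> powr \<epsilon>)"

definition diff_reps_small :: "(nat \<Rightarrow> int) \<Rightarrow> bool" where
  "diff_reps_small f \<longleftrightarrow> (\<forall>\<epsilon>>0. \<exists>C n0. \<forall>n::int. n \<ge> n0 \<longrightarrow>
      finite (diff_reps f n) \<and> real (card (diff_reps f n)) \<le> C * real_of_int n powr \<epsilon>)"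

definition discrepancy :: "(nat \<Rightarrow> real) \<Rightarrow> nat \<Rightarrow> real" where
  "discrepancy x N = (SUP ab \<in> {(a, b). 0 \<le> a \<and> a < b \<and> b \<le> (1::real)}.
      \<bar>real (card {n \<in> {1..N}. x n \<in> {fst ab..<snd ab}}) / real N - (snd ab - fst ab)\<bar>)"

end

theory Submission
  imports Defs
begin

text \<open>
  Let \<open>F N \<alpha>\<close> be the exponential sum of \<open>f n * \<alpha>\<close> over \<open>1 \<le> n \<le> N\<close>, let \<open>r k\<close> count the
  pairs with difference \<open>k\<close>, so that \<open>\<bar>F N\<bar>\<^sup>2\<close> has Fourier coefficients \<open>r k\<close>, and let \<open>E = r 0 \<ge> N\<close>.
  Few representations, as differences or as sums, bound the additive energy \<open>\<Sum>k. (r k)\<^sup>2\<close> by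
  \<open>N\<close> to a small power times \<open>E\<^sup>2\<close>: the finitely many \<open>k\<close> not covered by the hypothesis contribute at
  most \<open>E\<^sup>2\<close> each. This fourth moment alone only makes \<open>\<bar>F N\<bar>\<close> large on a set of
  measure a negative power of \<open>N\<close>. Averaging \<open>\<bar>F N (h * \<alpha>)\<bar>\<^sup>2\<close> over \<open>1 \<le> h \<le> H\<close> repairs this: by
  Parseval and the divisor bound, the variance of the average is at most \<open>E\<^sup>2 / H\<close> up to small
  powers of \<open>N\<close>. With \<open>N = 2 ^ (q * j)\<close> and \<open>H = 2 ^ j\<close> the relative variances are summable in \<open>j\<close>,
  so for almost all \<open>\<alpha>\<close> and all large \<open>j\<close> some \<open>h \<le> H\<close> has \<open>\<bar>F N (h * \<alpha>)\<bar>\<^sup>2 \<ge> N / 4\<close>.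
  Koksma's inequality \<open>\<bar>F N (h * \<alpha>)\<bar> \<le> 2 * pi * h * N * D\<^sub>N\<close> then loses only the
  factor \<open>H\<close>, the power \<open>1 / q\<close> of \<open>N\<close>.
\<close>

section \<open>The divisor bound\<close>

text \<open>Every divisor of a product splits into divisors of the two factors, so the pairs
  \<open>(i, d)\<close> map onto the divisors; surjectivity suffices for an upper bound.\<close>

lemma card_divisors_prime_power_mult_le:
  fixes p m :: nat
  assumes "prime p" "m > 0"
  shows "card {d. d dvd p ^ a * m} \<le> (a + 1) * card {d. d dvd m}"
proof -
  have fin: "finite {d. d dvd m}" using assms(2) by simp
  have "{d. d dvd p ^ a * m} \<subseteq> (\<lambda>(i, d). p ^ i * d) ` ({..a} \<times> {d. d dvd m})"
  proof
    fix d assume "d \<in> {d. d dvd p ^ a * m}"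
    then obtain u v where uv: "d = u * v" "u dvd p ^ a" "v dvd m"
      using division_decomp by blast
    then obtain i where "i \<le> a" "u = p ^ i" using divides_primepow_nat assms(1) by blast
    with uv show "d \<in> (\<lambda>(i, d). p ^ i * d) ` ({..a} \<times> {d. d dvd m})" by auto
  qed
  then have "card {d. d dvd p ^ a * m} \<le> card ({..a} \<times> {d. d dvd m})"
    by (rule surj_card_le[rotated]) (use fin in simp)
  then show ?thesis by (simp add: card_cartesian_product)
qed

text \<open>Peeling off one prime power at a time compares \<open>a + 1\<close> with
  \<open>(p ^ a) powr \<delta>\<close>: primes from \<open>P\<close> on lose nothing, and each
  smaller prime loses at most a factor \<open>K\<close>.\<close>

lemma card_divisors_le_powr:
  fixes \<delta> :: real
  assumes "\<delta> > 0"
  obtains C where "C \<ge> 0" "\<And>m::nat. m > 0 \<Longrightarrow> real (card {d. d dvd m}) \<le> C * real m powr \<delta>"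
proof -
  \<comment> \<open>Beyond \<open>P\<close>, \<open>p powr \<delta> \<ge> 2\<close>, hence
    \<open>(p ^ a) powr \<delta> \<ge> 2 ^ a \<ge> a + 1\<close>. \<open>K\<close> is chosen so that
    \<open>K * (1 + a * \<delta> * ln 2)\<close> expands to \<open>1 + a\<close> plus nonnegative
    terms.\<close>
  define P where "P = nat \<lceil>2 powr (1 / \<delta>)\<rceil>"
  define K :: real where "K = 1 + 1 / (\<delta> * ln 2)"
  have K1: "K \<ge> 1" using assms by (simp add: K_def)
  define S where "S m = {p. p < P \<and> prime p \<and> p dvd m}" for m :: nat
  have finS: "finite (S m)" for m by (simp add: S_def)
  have small: "real a + 1 \<le> K * real (p ^ a) powr \<delta>" if "prime p" for p a :: nat
  proof -
    have p2: "p \<ge> 2" using that prime_ge_2_nat by blast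
    have "real a + 1 \<le> K * (1 + a * \<delta> * ln 2)"
    proof -
      have "K * (1 + a * \<delta> * ln 2) = 1 + a + 1 / (\<delta> * ln 2) + a * \<delta> * ln 2"
        using assms by (simp add: K_def field_simps)
      then show ?thesis using assms by simp
    qed
    also have "\<dots> \<le> K * exp (a * \<delta> * ln 2)"
      using K1 exp_ge_add_one_self by (intro mult_left_mono) auto
    also have "exp (a * \<delta> * ln 2) = (2 ^ a) powr \<delta>"
      by (simp add: powr_def ln_realpow mult_ac)
    also have "K * \<dots> \<le> K * real (p ^ a) powr \<delta>"
      using p2 assms K1 by (intro mult_left_mono powr_mono2) (auto intro!: power_mono)
    finally show ?thesis .
  qed
  have large: "real a + 1 \<le> real (p ^ a) powr \<delta>" if "prime p" "p \<ge> P" for p a :: nat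
  proof -
    have p0: "real p > 0" using that(1) prime_gt_0_nat by simp
    have "2 powr (1 / \<delta>) \<le> real p" using that(2) unfolding P_def by linarith
    then have "(2 powr (1 / \<delta>)) powr \<delta> \<le> real p powr \<delta>" using assms by (intro powr_mono2) auto
    then have two: "2 \<le> real p powr \<delta>" using assms by (simp add: powr_powr)
    have "real a + 1 \<le> 2 ^ a"
    proof -
      have "Suc a \<le> 2 ^ a" by (simp add: Suc_leI)
      then have "real (Suc a) \<le> real (2 ^ a)" using of_nat_le_iff by blast
      then show ?thesis by simp
    qed
    also have "\<dots> \<le> (real p powr \<delta>) ^ a" using two by (intro power_mono) auto
    also have "\<dots> = real (p ^ a) powr \<delta>" using p0 by (simp add: powr_power powr_powr flip: powr_realpow) (simp add: mult.commute)
    finally show ?thesis .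
  qed
  \<comment> \<open>The exponent counts only the prime divisors below \<open>P\<close>: removing the
    full power of such a prime lowers it by one, which pays for one factor \<open>K\<close>.\<close>
  have main: "real (card {d. d dvd m}) \<le> K ^ card (S m) * real m powr \<delta>" if "m > 0" for m
    using that
  proof (induction m rule: less_induct)
    case (less m)
    show ?case
    proof (cases "m = 1")
      case True
      then show ?thesis using K1 by (simp add: S_def)
    next
      case False
      then obtain p where p: "prime p" "p dvd m" using prime_factor_nat by blast
      obtain m' where m': "m = p ^ multiplicity p m * m'" "\<not> p dvd m'"
        using multiplicity_decompose' less.prems p(1)
        by (metis not_prime_unit not_gr_zero)
      define a where "a = multiplicity p m"
      have a: "m = p ^ a * m'" "a > 0" using m' p less.prems
        by (auto simp: a_def prime_multiplicity_gt_zero_iff)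
      have m'0: "m' > 0" using a less.prems by (metis mult_0_right not_gr_zero)
      have "1 < p ^ a" using a(2) prime_gt_1_nat[OF p(1)] by (rule one_less_power[rotated])
      then have "m' < m" using m'0 a(1) by simp
      note IH = less.IH[OF this m'0]
      have split: "real m powr \<delta> = real (p ^ a) powr \<delta> * real m' powr \<delta>"
        by (simp add: a(1) powr_mult)
      have "real (card {d. d dvd m}) \<le> (real a + 1) * real (card {d. d dvd m'})"
        using card_divisors_prime_power_mult_le[OF p(1) m'0, of a] unfolding a(1)[symmetric]
        by (simp add: algebra_simps flip: of_nat_le_iff[where ?'a = real])
      also have "\<dots> \<le> (real a + 1) * (K ^ card (S m') * real m' powr \<delta>)"
        using IH by (intro mult_left_mono) auto
      also have "\<dots> \<le> K ^ card (S m) * real m powr \<delta>"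
      proof (cases "p < P")
        case True
        have "S m = insert p (S m')"
        proof -
          have "q dvd m \<longleftrightarrow> q = p \<or> q dvd m'" if "prime q" for q
            using that p(1) a(2) unfolding a(1)
            by (metis dvd_triv_left dvd_mult dvd_mult2 dvd_power prime_dvd_mult_iff prime_dvd_power primes_dvd_imp_eq)
          then show ?thesis using p True by (auto simp: S_def)
        qed
        moreover have "p \<notin> S m'" using m' by (simp add: S_def)
        ultimately have "card (S m) = Suc (card (S m'))" using finS by simp
        then have "K ^ card (S m) * real m powr \<delta> = (K * real (p ^ a) powr \<delta>) * (K ^ card (S m') * real m' powr \<delta>)"
          by (simp add: split)
        then show ?thesis using small[OF p(1), of a] K1 by (simp add: mult_right_mono del: of_nat_power)
      next
        case False
        have "card (S m') \<le> card (S m)" using a(1) finS by (intro card_mono) (auto simp: S_def)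
        then have "K ^ card (S m') \<le> K ^ card (S m)" using K1 by (simp add: power_increasing)
        then have "(real a + 1) * (K ^ card (S m') * real m' powr \<delta>)
            \<le> real (p ^ a) powr \<delta> * (K ^ card (S m) * real m' powr \<delta>)"
          using large[OF p(1)] False K1 by (intro mult_mono mult_right_mono) auto
        then show ?thesis by (simp add: split mult_ac)
      qed
      finally show ?thesis .
    qed
  qed
  have "real (card {d. d dvd m}) \<le> K ^ P * real m powr \<delta>" if "m > 0" for m :: nat
  proof -
    have "card (S m) \<le> card {..<P}" by (intro card_mono) (auto simp: S_def)
    then have "K ^ card (S m) \<le> K ^ P" using K1 by (simp add: power_increasing)
    then have "K ^ card (S m) * real m powr \<delta> \<le> K ^ P * real m powr \<delta>" by (intro mult_right_mono) auto
    with main[OF that] show ?thesis by linarith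
  qed
  moreover have "K ^ P \<ge> 0" using K1 by simp
  ultimately show ?thesis using that by blast
qed

section \<open>Additive energy\<close>

text \<open>This is the \<open>r\<close> of the overview. Truncation to \<open>{1..N}\<close> keeps
  it finite even at \<open>k = 0\<close>, where all pairs \<open>(x, x)\<close> occur.\<close>

definition diff_count :: "(nat \<Rightarrow> int) \<Rightarrow> nat \<Rightarrow> int \<Rightarrow> nat" where
  "diff_count f N k = card {(x, y) \<in> {1..N} \<times> {1..N}. f x - f y = k}"

definition sum_count :: "(nat \<Rightarrow> int) \<Rightarrow> nat \<Rightarrow> int \<Rightarrow> nat" where
  "sum_count f N k = card {(x, y) \<in> {1..N} \<times> {1..N}. f x + f y = k}"

text \<open>Coinciding pairs are sorted by their common value. With \<open>g = g'\<close> this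
  writes an energy as a sum of squared multiplicities.\<close>

lemma card_coincidences_eq_sum:
  assumes "finite X" "finite Y" "finite V" "g ` X \<subseteq> V"
  shows "card {(x, y) \<in> X \<times> Y. g x = g' y} = (\<Sum>v\<in>V. card {x \<in> X. g x = v} * card {y \<in> Y. g' y = v})"
proof -
  have "{(x, y) \<in> X \<times> Y. g x = g' y} = (\<Union>v\<in>V. {x \<in> X. g x = v} \<times> {y \<in> Y. g' y = v})"
    using assms by auto
  also have "card \<dots> = (\<Sum>v\<in>V. card ({x \<in> X. g x = v} \<times> {y \<in> Y. g' y = v}))"
    using assms by (intro card_UN_disjoint) auto
  finally show ?thesis by (simp add: card_cartesian_product)
qed

text \<open>This is \<open>2 * (a * b) \<le> a * a + b * b\<close> for the multiplicities of each
  value. It bounds all difference and sum counts by the count of the zero difference, since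
  translating or reflecting \<open>f\<close> keeps its self-coincidences.\<close>

lemma card_coincidences_le:
  assumes "finite X" "finite Y"
  shows "2 * card {(x, y) \<in> X \<times> Y. g x = g' y} \<le>
    card {(x, y) \<in> X \<times> X. g x = g y} + card {(x, y) \<in> Y \<times> Y. g' x = g' y}"
proof -
  define V where "V = g ` X \<union> g' ` Y"
  have V: "finite V" "g ` X \<subseteq> V" "g' ` Y \<subseteq> V" using assms by (auto simp: V_def)
  have amgm: "2 * (a * b) \<le> a * a + b * b" for a b :: nat
  proof -
    have "0 \<le> (int a - int b)\<^sup>2" by simp
    then have "int (2 * (a * b)) \<le> int (a * a + b * b)" by (simp add: power2_eq_square algebra_simps)
    then show ?thesis by (simp only: of_nat_le_iff)
  qed
  show ?thesis
    unfolding card_coincidences_eq_sum[OF assms V(1,2)]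
      card_coincidences_eq_sum[OF assms(1) assms(1) V(1,2)] card_coincidences_eq_sum[OF assms(2) assms(2) V(1,3)]
      sum_distrib_left sum.distrib[symmetric]
    by (intro sum_mono amgm)
qed

lemma diff_count_le: "diff_count f N k \<le> diff_count f N 0"
  using card_coincidences_le[of "{1..N}" "{1..N}" f "\<lambda>y. f y + k"]
  by (simp add: diff_count_def diff_eq_eq add.commute)

lemma sum_count_le: "sum_count f N k \<le> diff_count f N 0"
proof -
  have "(f x + f y = k) = (f x = k - f y)" for x y by auto
  then show ?thesis
    using card_coincidences_le[of "{1..N}" "{1..N}" f "\<lambda>y. k - f y"]
    by (simp add: diff_count_def sum_count_def)
qed

lemma diff_count_0_ge: "N \<le> diff_count f N 0"
proof -
  have "finite {(x, y) \<in> {1..N} \<times> {1..N}. f x - f y = 0}"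
    by (rule finite_subset[of _ "{1..N} \<times> {1..N}"]) auto
  then have "card ((\<lambda>x. (x, x)) ` {1..N}) \<le> diff_count f N 0"
    unfolding diff_count_def by (rule card_mono) auto
  then show ?thesis by (simp add: card_image inj_on_def)
qed

lemma sum_fibre_card:
  assumes "finite S" "finite V" "\<phi> ` S \<subseteq> V"
  shows "(\<Sum>v\<in>V. card {p \<in> S. \<phi> p = v}) = card S"
proof -
  have "S = (\<Union>v\<in>V. {p \<in> S. \<phi> p = v})" using assms by auto
  then have "card S = card (\<Union>v\<in>V. {p \<in> S. \<phi> p = v})" by simp
  also have "\<dots> = (\<Sum>v\<in>V. card {p \<in> S. \<phi> p = v})"
    using assms by (intro card_UN_disjoint) auto
  finally show ?thesis ..
qed

text \<open>The equation \<open>f x - f y = f z - f w\<close> is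
  \<open>f x + f w = f z + f y\<close>, so both sides count the same quadruples up to exchanging
  \<open>y\<close> and \<open>w\<close>. Hence a hypothesis on sums controls the energy of
  differences.\<close>

lemma sum_diff_count_sq_eq:
  assumes "\<And>x. x \<in> {1..N} \<Longrightarrow> 2 * \<bar>f x\<bar> \<le> B"
  shows "(\<Sum>k=-B..B. (diff_count f N k)\<^sup>2) = (\<Sum>k=-B..B. (sum_count f N k)\<^sup>2)"
proof -
  let ?X = "{1..N} \<times> {1..N}"
  have bnd: "- B \<le> f x - f y \<and> f x - f y \<le> B \<and> - B \<le> f x + f y \<and> f x + f y \<le> B"
    if "x \<in> {1..N}" "y \<in> {1..N}" for x y
    using assms[OF that(1)] assms[OF that(2)] by (simp add: abs_if split: if_splits)
  have in1: "(\<lambda>(x, y). f x - f y) ` ?X \<subseteq> {-B..B}" "(\<lambda>(x, y). f x + f y) ` ?X \<subseteq> {-B..B}"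
    using bnd by force+
  have cnt: "diff_count f N v = card {p \<in> ?X. (case p of (x, y) \<Rightarrow> f x - f y) = v}"
    "sum_count f N v = card {p \<in> ?X. (case p of (x, y) \<Rightarrow> f x + f y) = v}" for v
    unfolding diff_count_def sum_count_def by (auto intro!: arg_cong[where f = card])
  have d: "(\<Sum>k=-B..B. (diff_count f N k)\<^sup>2) =
      card {(p, q) \<in> ?X \<times> ?X. (case p of (x, y) \<Rightarrow> f x - f y) = (case q of (x, y) \<Rightarrow> f x - f y)}"
    using card_coincidences_eq_sum[OF _ _ _ in1(1), of ?X "\<lambda>(x, y). f x - f y"]
    by (simp add: cnt power2_eq_square)
  have s: "(\<Sum>k=-B..B. (sum_count f N k)\<^sup>2) =
      card {(p, q) \<in> ?X \<times> ?X. (case p of (x, y) \<Rightarrow> f x + f y) = (case q of (x, y) \<Rightarrow> f x + f y)}"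
    using card_coincidences_eq_sum[OF _ _ _ in1(2), of ?X "\<lambda>(x, y). f x + f y"]
    by (simp add: cnt power2_eq_square)
  show ?thesis unfolding d s
    by (rule bij_betw_same_card[of "\<lambda>((x, y), (z, w)). ((x, w), (z, y))"],
        rule bij_betw_byWitness[where f' = "\<lambda>((x, y), (z, w)). ((x, w), (z, y))"]) auto
qed

text \<open>Off the centre \<open>u k * u k \<le> c * u k\<close>, and the total mass is at most
  \<open>E\<^sup>2\<close>; each of the at most \<open>2 * L + 1\<close> central values costs
  \<open>E\<^sup>2\<close> by the pointwise bound.\<close>

lemma sum_sq_le_of_small_off_centre:
  fixes u :: "int \<Rightarrow> nat" and E L :: nat and c :: real
  assumes "c \<ge> 0" "\<And>k. u k \<le> E" "(\<Sum>k=-B..B. u k) \<le> E\<^sup>2"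
    and small: "\<And>k. \<bar>k\<bar> \<ge> int L \<Longrightarrow> \<bar>k\<bar> \<le> B \<Longrightarrow> real (u k) \<le> c"
  shows "real (\<Sum>k=-B..B. (u k)\<^sup>2) \<le> (2 * real L + 1 + c) * (real E)\<^sup>2"
proof -
  have "real (\<Sum>k=-B..B. (u k)\<^sup>2) \<le> (\<Sum>k=-B..B. c * real (u k) + (if k \<in> {-int L..int L} then (real E)\<^sup>2 else 0))"
    unfolding of_nat_sum
  proof (rule sum_mono)
    fix k assume k: "k \<in> {-B..B}"
    show "real ((u k)\<^sup>2) \<le> c * real (u k) + (if k \<in> {-int L..int L} then (real E)\<^sup>2 else 0)"
    proof (cases "k \<in> {-int L..int L}")
      case True
      then show ?thesis using assms(1,2) by (simp add: power_mono add_increasing)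
    next
      case False
      then have "real (u k) \<le> c" using k by (intro small) auto
      then have "real (u k) * real (u k) \<le> c * real (u k)" by (intro mult_right_mono) auto
      with False show ?thesis by (simp only: power2_eq_square of_nat_mult if_False add_0_right)
    qed
  qed
  also have "\<dots> = c * real (\<Sum>k=-B..B. u k) + (\<Sum>k\<in>{-B..B} \<inter> {-int L..int L}. (real E)\<^sup>2)"
    unfolding sum.distrib sum_distrib_left of_nat_sum by (subst sum.inter_restrict) simp_all
  also have "\<dots> \<le> c * (real E)\<^sup>2 + (2 * real L + 1) * (real E)\<^sup>2"
  proof (intro add_mono mult_left_mono)
    show "real (\<Sum>k=-B..B. u k) \<le> (real E)\<^sup>2" using assms(3) by (metis of_nat_le_iff of_nat_power)
    have "card ({-B..B} \<inter> {-int L..int L}) \<le> card {-int L..int L}" by (intro card_mono) auto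
    then have "real (card ({-B..B} \<inter> {-int L..int L})) \<le> 2 * real L + 1" by simp
    then show "(\<Sum>k\<in>{-B..B} \<inter> {-int L..int L}. (real E)\<^sup>2) \<le> (2 * real L + 1) * (real E)\<^sup>2"
      by (simp add: mult_right_mono)
  qed (use assms in auto)
  finally show ?thesis by (simp add: algebra_simps)
qed

lemma sum_diff_count:
  assumes "\<And>x. x \<in> {1..N} \<Longrightarrow> 2 * \<bar>f x\<bar> \<le> B"
  shows "(\<Sum>k=-B..B. diff_count f N k) = N\<^sup>2" "(\<Sum>k=-B..B. sum_count f N k) = N\<^sup>2"
proof -
  let ?X = "{1..N} \<times> {1..N}"
  have bnd: "- B \<le> f x - f y \<and> f x - f y \<le> B \<and> - B \<le> f x + f y \<and> f x + f y \<le> B"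
    if "x \<in> {1..N}" "y \<in> {1..N}" for x y
    using assms[OF that(1)] assms[OF that(2)] by (simp add: abs_if split: if_splits)
  have in1: "(\<lambda>(x, y). f x - f y) ` ?X \<subseteq> {-B..B}" "(\<lambda>(x, y). f x + f y) ` ?X \<subseteq> {-B..B}"
    using bnd by force+
  have cnt: "diff_count f N v = card {p \<in> ?X. (case p of (x, y) \<Rightarrow> f x - f y) = v}"
    "sum_count f N v = card {p \<in> ?X. (case p of (x, y) \<Rightarrow> f x + f y) = v}" for v
    unfolding diff_count_def sum_count_def by (auto intro!: arg_cong[where f = card])
  show "(\<Sum>k=-B..B. diff_count f N k) = N\<^sup>2"
    using sum_fibre_card[OF _ _ in1(1)] by (simp add: cnt power2_eq_square)
  show "(\<Sum>k=-B..B. sum_count f N k) = N\<^sup>2"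
    using sum_fibre_card[OF _ _ in1(2)] by (simp add: cnt power2_eq_square)
qed

lemma additive_energy_le:
  assumes "\<delta> > 0" "sum_reps_small f \<or> diff_reps_small f"
  obtains C where "C \<ge> 0" "\<And>N B. B \<ge> 1 \<Longrightarrow> (\<And>x. x \<in> {1..N} \<Longrightarrow> 2 * \<bar>f x\<bar> \<le> B) \<Longrightarrow>
    real (\<Sum>k=-B..B. (diff_count f N k)\<^sup>2) \<le> C * real_of_int B powr \<delta> * (real (diff_count f N 0))\<^sup>2"
proof -
  \<comment> \<open>One estimate serves both cases, with \<open>u\<close> the difference or the sum
    counts. \<open>\<bar>C\<bar>\<close> replaces \<open>C\<close>, whose sign is unknown, and
    \<open>B powr \<delta> \<ge> 1\<close> lets the central term take the same factor.\<close>
  have energy: "real (\<Sum>k=-B..B. (u k)\<^sup>2) \<le> (2 * real L + 1 + \<bar>C\<bar>) * real_of_int B powr \<delta> * (real (diff_count f N 0))\<^sup>2"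
    if "B \<ge> 1" "\<And>k. u k \<le> diff_count f N 0" "(\<Sum>k=-B..B. u k) = N\<^sup>2"
      and u: "\<And>k. \<bar>k\<bar> \<ge> int L \<Longrightarrow> real (u k) \<le> C * real_of_int \<bar>k\<bar> powr \<delta>" for u N B L C
  proof -
    let ?E = "diff_count f N 0"
    have "real (\<Sum>k=-B..B. (u k)\<^sup>2) \<le> (2 * real L + 1 + \<bar>C\<bar> * real_of_int B powr \<delta>) * (real ?E)\<^sup>2"
    proof (rule sum_sq_le_of_small_off_centre)
      show "(\<Sum>k=-B..B. u k) \<le> ?E\<^sup>2" using that(3) diff_count_0_ge by (simp add: power_mono)
      fix k assume k: "\<bar>k\<bar> \<ge> int L" "\<bar>k\<bar> \<le> B"
      have "C * real_of_int \<bar>k\<bar> powr \<delta> \<le> \<bar>C\<bar> * real_of_int B powr \<delta>"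
        using k assms(1) by (intro mult_mono powr_mono2) auto
      with u[OF k(1)] show "real (u k) \<le> \<bar>C\<bar> * real_of_int B powr \<delta>" by linarith
    qed (use that in auto)
    also have "\<dots> \<le> ((2 * real L + 1) * real_of_int B powr \<delta> + \<bar>C\<bar> * real_of_int B powr \<delta>) * (real ?E)\<^sup>2"
      using that(1) assms(1) ge_one_powr_ge_zero[of "real_of_int B" \<delta>]
      by (intro mult_right_mono add_right_mono) auto
    finally show ?thesis by (simp add: algebra_simps)
  qed
  show ?thesis
  proof (cases "diff_reps_small f")
    case True
    then obtain C n0 where Cn: "\<And>n. n \<ge> n0 \<Longrightarrow> finite (diff_reps f n) \<and> real (card (diff_reps f n)) \<le> C * real_of_int n powr \<delta>"
      using assms(1) unfolding diff_reps_small_def by meson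
    have "real (diff_count f N k) \<le> C * real_of_int \<bar>k\<bar> powr \<delta>" if "\<bar>k\<bar> \<ge> int (nat n0)" for N k
    proof -
      have k: "\<bar>k\<bar> \<ge> n0" using that by linarith
      \<comment> \<open>The hypothesis on differences concerns \<open>n \<ge> n0\<close> only; for
        negative \<open>k\<close>, exchanging the entries of a pair turns its difference into
        \<open>\<bar>k\<bar>\<close>.\<close>
      have sub: "diff_count f N k \<le> card (diff_reps f \<bar>k\<bar>)"
      proof (cases "k \<ge> 0")
        case True
        then show ?thesis using Cn[OF k] unfolding diff_count_def
          by (intro card_mono) (auto simp: diff_reps_def)
      next
        case False
        then show ?thesis using Cn[OF k] unfolding diff_count_def
          by (intro card_inj_on_le[of prod.swap]) (auto simp: diff_reps_def)
      qed
      then show ?thesis using Cn[OF k] by linarith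
    qed
    then have "real (\<Sum>k=-B..B. (diff_count f N k)\<^sup>2) \<le>
        (2 * real (nat n0) + 1 + \<bar>C\<bar>) * real_of_int B powr \<delta> * (real (diff_count f N 0))\<^sup>2"
      if "B \<ge> 1" "\<And>x. x \<in> {1..N} \<Longrightarrow> 2 * \<bar>f x\<bar> \<le> B" for N B
      using that by (intro energy diff_count_le sum_diff_count(1))
    then show ?thesis
      by (intro that[of "2 * real (nat n0) + 1 + \<bar>C\<bar>"]) (auto)
  next
    case False
    then obtain C n0 where Cn: "\<And>n. \<bar>n\<bar> \<ge> n0 \<Longrightarrow> finite (sum_reps f n) \<and> real (card (sum_reps f n)) \<le> C * real_of_int \<bar>n\<bar> powr \<delta>"
      using assms unfolding sum_reps_small_def by meson
    have "real (sum_count f N k) \<le> C * real_of_int \<bar>k\<bar> powr \<delta>" if "\<bar>k\<bar> \<ge> int (nat n0)" for N k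
    proof -
      have k: "\<bar>k\<bar> \<ge> n0" using that by linarith
      have "sum_count f N k \<le> card (sum_reps f k)"
        using Cn[OF k] unfolding sum_count_def by (intro card_mono) (auto simp: sum_reps_def)
      then show ?thesis using Cn[OF k] by linarith
    qed
    then have "real (\<Sum>k=-B..B. (sum_count f N k)\<^sup>2) \<le>
        (2 * real (nat n0) + 1 + \<bar>C\<bar>) * real_of_int B powr \<delta> * (real (diff_count f N 0))\<^sup>2"
      if "B \<ge> 1" "\<And>x. x \<in> {1..N} \<Longrightarrow> 2 * \<bar>f x\<bar> \<le> B" for N B
      using that by (intro energy sum_count_le sum_diff_count(2))
    then show ?thesis
      by (intro that[of "2 * real (nat n0) + 1 + \<bar>C\<bar>"]) (auto simp only: sum_diff_count_sq_eq)
  qed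
qed

section \<open>Mean values of exponential sums\<close>

text \<open>Every interval between consecutive integers is covered, because the almost-everywhere
  statement on the line is assembled from these.\<close>

lemma has_integral_cos_period:
  fixes k m :: int
  shows "((\<lambda>\<alpha>. cos (2 * pi * of_int k * \<alpha>)) has_integral (if k = 0 then 1 else 0)) {of_int m..of_int m + 1 :: real}"
proof (cases "k = 0")
  case True
  then show ?thesis using has_integral_const_real[of "1::real" "of_int m" "of_int m + 1"] by simp
next
  case False
  define c where "c = 2 * pi * real_of_int k"
  have c: "c \<noteq> 0" using False by (simp add: c_def)
  have "((\<lambda>\<alpha>. cos (c * \<alpha>)) has_integral (sin (c * (of_int m + 1)) / c - sin (c * of_int m) / c)) {of_int m..of_int m + 1}"
    using c by (intro fundamental_theorem_of_calculus)
      (auto intro!: derivative_eq_intros simp flip: has_real_derivative_iff_has_vector_derivative)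
  moreover have "sin (c * of_int n) = 0" for n :: int
  proof -
    have "c * of_int n = of_int (2 * k * n) * pi" by (simp add: c_def)
    then show ?thesis using sin_zero_iff_int2 by blast
  qed
  from this[of m] this[of "m + 1"] have "sin (c * of_int m) = 0" "sin (c * (of_int m + 1)) = 0" by simp_all
  ultimately show ?thesis using False by (simp add: c_def)
qed

text \<open>The coefficients are real, so the squared modulus expands into cosines, and only the
  diagonal terms survive integration.\<close>

lemma parseval_trig_poly:
  fixes c :: "int \<Rightarrow> real" and m :: int
  assumes "finite K"
  shows "(\<integral>\<^sup>+\<alpha>. ennreal ((cmod (\<Sum>k\<in>K. of_real (c k) * cis (2 * pi * of_int k * \<alpha>)))\<^sup>2)
      * indicator {of_int m..of_int m + 1} \<alpha> \<partial>lborel) = ennreal (\<Sum>k\<in>K. (c k)\<^sup>2)"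
proof -
  let ?S = "{of_int m..of_int m + 1 :: real}"
  let ?P = "\<lambda>\<alpha>. \<Sum>k\<in>K. of_real (c k) * cis (2 * pi * of_int k * \<alpha>)"
  have expand: "(cmod (?P \<alpha>))\<^sup>2 = (\<Sum>k\<in>K. \<Sum>l\<in>K. c k * c l * cos (2 * pi * of_int (k - l) * \<alpha>))" for \<alpha>
  proof -
    have "(cmod (?P \<alpha>))\<^sup>2 = Re (?P \<alpha> * cnj (?P \<alpha>))"
      by (metis Re_complex_of_real complex_norm_square)
    also have "?P \<alpha> * cnj (?P \<alpha>) = (\<Sum>k\<in>K. \<Sum>l\<in>K. of_real (c k * c l) * cis (2 * pi * of_int (k - l) * \<alpha>))"
    proof -
      have "(a * cis (2 * pi * of_int k * \<alpha>)) * cnj (b * cis (2 * pi * of_int l * \<alpha>)) =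
          a * cnj b * cis (2 * pi * of_int (k - l) * \<alpha>)" for a b k l
      proof -
        have "cis (2 * pi * of_int k * \<alpha>) * cnj (cis (2 * pi * of_int l * \<alpha>)) = cis (2 * pi * of_int (k - l) * \<alpha>)"
          by (simp add: cis_cnj cis_mult algebra_simps)
        then show ?thesis by (simp add: mult.assoc mult.left_commute)
      qed
      then show ?thesis unfolding cnj_sum sum_product by (simp only: complex_cnj_complex_of_real of_real_mult)
    qed
    finally show ?thesis by simp
  qed
  have "((\<lambda>\<alpha>. \<Sum>k\<in>K. \<Sum>l\<in>K. c k * c l * cos (2 * pi * of_int (k - l) * \<alpha>)) has_integral
      (\<Sum>k\<in>K. \<Sum>l\<in>K. c k * c l * (if k - l = 0 then 1 else 0))) ?S"
    using assms by (intro has_integral_sum has_integral_mult_right has_integral_cos_period)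
  also have "(\<Sum>k\<in>K. \<Sum>l\<in>K. c k * c l * (if k - l = 0 then 1 else 0)) = (\<Sum>k\<in>K. (c k)\<^sup>2)"
    using assms by (simp add: power2_eq_square if_distrib sum.delta cong: if_cong)
  finally have "((\<lambda>\<alpha>. (cmod (?P \<alpha>))\<^sup>2) has_integral (\<Sum>k\<in>K. (c k)\<^sup>2)) ?S"
    unfolding expand .
  then have hi: "((\<lambda>\<alpha>. indicator ?S \<alpha> * (cmod (?P \<alpha>))\<^sup>2) has_integral (\<Sum>k\<in>K. (c k)\<^sup>2)) UNIV"
    by (subst (asm) has_integral_restrict_UNIV[symmetric])
      (auto elim!: has_integral_eq_rhs has_integral_eq[rotated] simp: indicator_def)
  have meas: "(\<lambda>\<alpha>. indicator ?S \<alpha> * (cmod (?P \<alpha>))\<^sup>2) \<in> borel_measurable borel"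
    unfolding expand by measurable
  have "(\<integral>\<^sup>+\<alpha>. ennreal ((cmod (?P \<alpha>))\<^sup>2) * indicator ?S \<alpha> \<partial>lborel) =
      (\<integral>\<^sup>+\<alpha>. ennreal (indicator ?S \<alpha> * (cmod (?P \<alpha>))\<^sup>2) \<partial>lborel)"
    by (intro nn_integral_cong) (auto simp: indicator_def)
  also have "\<dots> = ennreal (\<Sum>k\<in>K. (c k)\<^sup>2)"
    by (rule nn_integral_has_integral_lborel[OF meas _ hi]) simp
  finally show ?thesis .
qed

text \<open>Expand the square and group the pairs by their difference; the bound on \<open>f\<close>
  confines all differences to \<open>{-B..B}\<close>. The constant term
  \<open>diff_count f N 0\<close> is the mean over a unit interval.\<close>

lemma norm_sq_exponential_sum:
  assumes "\<And>x. x \<in> {1..N} \<Longrightarrow> 2 * \<bar>f x\<bar> \<le> B"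
  shows "of_real ((cmod (\<Sum>n=1..N. cis (2 * pi * of_int (f n) * \<alpha>)))\<^sup>2) =
    (\<Sum>k=-B..B. of_real (real (diff_count f N k)) * cis (2 * pi * of_int k * \<alpha>))"
proof -
  let ?X = "{1..N} \<times> {1..N}" and ?e = "\<lambda>k. cis (2 * pi * of_int k * \<alpha>)"
  let ?\<phi> = "\<lambda>(x, y). f x - f y"
  have img: "?\<phi> ` ?X \<subseteq> {-B..B}"
  proof -
    have "- B \<le> f x - f y \<and> f x - f y \<le> B" if "x \<in> {1..N}" "y \<in> {1..N}" for x y
      using assms[OF that(1)] assms[OF that(2)] by (simp add: abs_if split: if_splits)
    then show ?thesis by force
  qed
  have prod: "?e k * cnj (?e l) = ?e (k - l)" for k l
    by (simp add: cis_cnj cis_mult algebra_simps)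
  have "of_real ((cmod (\<Sum>n=1..N. ?e (f n)))\<^sup>2) = (\<Sum>n=1..N. ?e (f n)) * cnj (\<Sum>n=1..N. ?e (f n))"
    by (simp only: complex_norm_square)
  also have "\<dots> = (\<Sum>x=1..N. \<Sum>y=1..N. ?e (f x - f y))"
    unfolding cnj_sum sum_product prod ..
  also have "\<dots> = (\<Sum>p\<in>?X. ?e (?\<phi> p))"
    unfolding sum.cartesian_product by (intro sum.cong) auto
  also have "\<dots> = (\<Sum>k=-B..B. \<Sum>p\<in>{p \<in> ?X. ?\<phi> p = k}. ?e (?\<phi> p))"
    using img by (intro sum.group[symmetric]) auto
  also have "\<dots> = (\<Sum>k=-B..B. of_real (real (diff_count f N k)) * ?e k)"
  proof (intro sum.cong refl)
    fix k
    have "diff_count f N k = card {p \<in> ?X. ?\<phi> p = k}"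
      unfolding diff_count_def by (auto intro!: arg_cong[where f = card])
    moreover have "(\<Sum>p\<in>{p \<in> ?X. ?\<phi> p = k}. ?e (?\<phi> p)) = (\<Sum>p\<in>{p \<in> ?X. ?\<phi> p = k}. ?e k)"
      by (intro sum.cong) auto
    ultimately show "(\<Sum>p\<in>{p \<in> ?X. ?\<phi> p = k}. ?e (?\<phi> p)) = of_real (real (diff_count f N k)) * ?e k"
      by simp
  qed
  finally show ?thesis .
qed

text \<open>Collecting equal frequencies \<open>h * k\<close>, Cauchy's inequality loses at most the number of
  factorisations of a frequency.\<close>

lemma nn_integral_dilated_sums_le:
  fixes r :: "int \<Rightarrow> real" and H :: nat and m :: int and D :: real
  assumes "finite K" "0 \<notin> K"
    and D: "\<And>h k. h \<in> {1..H} \<Longrightarrow> k \<in> K \<Longrightarrow> real (card {d. d dvd nat \<bar>int h * k\<bar>}) \<le> D"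
  shows "(\<integral>\<^sup>+\<alpha>. ennreal ((cmod (\<Sum>h=1..H. \<Sum>k\<in>K. of_real (r k) * cis (2 * pi * of_int k * (real h * \<alpha>))))\<^sup>2)
      * indicator {of_int m..of_int m + 1} \<alpha> \<partial>lborel) \<le> ennreal (D * (real H * (\<Sum>k\<in>K. (r k)\<^sup>2)))"
proof -
  let ?X = "{1..H} \<times> K" and ?\<phi> = "\<lambda>(h, k). int h * k"
  define V where "V = ?\<phi> ` ?X"
  define R where "R v = (\<Sum>p\<in>{p \<in> ?X. ?\<phi> p = v}. r (snd p))" for v
  have fin: "finite ?X" "finite V" using assms(1) by (auto simp: V_def)
  have collect: "(\<Sum>h=1..H. \<Sum>k\<in>K. of_real (r k) * cis (2 * pi * of_int k * (real h * \<alpha>))) =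
      (\<Sum>v\<in>V. of_real (R v) * cis (2 * pi * of_int v * \<alpha>))" for \<alpha>
  proof -
    have "(\<Sum>h=1..H. \<Sum>k\<in>K. of_real (r k) * cis (2 * pi * of_int k * (real h * \<alpha>))) =
        (\<Sum>p\<in>?X. of_real (r (snd p)) * cis (2 * pi * of_int (?\<phi> p) * \<alpha>))"
      unfolding sum.cartesian_product by (intro sum.cong) (auto simp: mult_ac)
    also have "\<dots> = (\<Sum>v\<in>V. \<Sum>p\<in>{p \<in> ?X. ?\<phi> p = v}. of_real (r (snd p)) * cis (2 * pi * of_int (?\<phi> p) * \<alpha>))"
      using fin by (intro sum.group[symmetric]) (auto simp: V_def)
    also have "\<dots> = (\<Sum>v\<in>V. of_real (R v) * cis (2 * pi * of_int v * \<alpha>))"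
      unfolding R_def of_real_sum sum_distrib_right by (intro sum.cong) auto
    finally show ?thesis .
  qed
  \<comment> \<open>As \<open>0 \<notin> K\<close>, the value \<open>v\<close> is nonzero and has
    finitely many divisors; a pair in its fibre is determined by its first entry, which divides
    \<open>\<bar>v\<bar>\<close>.\<close>
  have fibre: "real (card {p \<in> ?X. ?\<phi> p = v}) \<le> D" if "v \<in> V" for v
  proof -
    obtain h k where hk: "h \<in> {1..H}" "k \<in> K" "v = int h * k" using \<open>v \<in> V\<close> by (auto simp: V_def)
    have v0: "v \<noteq> 0" using hk assms(2) by auto
    have "card {p \<in> ?X. ?\<phi> p = v} \<le> card {d. d dvd nat \<bar>v\<bar>}"
    proof (rule card_inj_on_le[of fst])
      show "inj_on fst {p \<in> ?X. ?\<phi> p = v}" by (auto simp: inj_on_def)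
      show "fst ` {p \<in> ?X. ?\<phi> p = v} \<subseteq> {d. d dvd nat \<bar>v\<bar>}"
        by (auto simp: abs_mult nat_mult_distrib)
      show "finite {d. d dvd nat \<bar>v\<bar>}" using v0 by (intro finite_divisors_nat) simp
    qed
    also have "real \<dots> \<le> D" using D[OF hk(1,2)] hk(3) by simp
    finally show ?thesis by simp
  qed
  have "(\<Sum>v\<in>V. (R v)\<^sup>2) \<le> (\<Sum>v\<in>V. D * (\<Sum>p\<in>{p \<in> ?X. ?\<phi> p = v}. (r (snd p))\<^sup>2))"
  proof (rule sum_mono)
    fix v assume v: "v \<in> V"
    have "(R v)\<^sup>2 \<le> (\<Sum>p\<in>{p \<in> ?X. ?\<phi> p = v}. (r (snd p))\<^sup>2) * real (card {p \<in> ?X. ?\<phi> p = v})"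
      unfolding R_def by (rule sum_squared_le_sum_of_squares)
    also have "\<dots> \<le> (\<Sum>p\<in>{p \<in> ?X. ?\<phi> p = v}. (r (snd p))\<^sup>2) * D"
      using fibre[OF v] by (intro mult_left_mono sum_nonneg) auto
    finally show "(R v)\<^sup>2 \<le> D * (\<Sum>p\<in>{p \<in> ?X. ?\<phi> p = v}. (r (snd p))\<^sup>2)" by (simp add: mult.commute)
  qed
  also have "\<dots> = D * (\<Sum>p\<in>?X. (r (snd p))\<^sup>2)"
    unfolding sum_distrib_left[symmetric]
    using fin by (intro arg_cong[where f = "(*) D"] sum.group) (auto simp: V_def)
  also have "(\<Sum>p\<in>?X. (r (snd p))\<^sup>2) = real H * (\<Sum>k\<in>K. (r k)\<^sup>2)"
    using sum.cartesian_product[of "\<lambda>h k. (r k)\<^sup>2" K "{1..H}"] by (simp add: case_prod_unfold)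
  finally show ?thesis
    unfolding collect parseval_trig_poly[OF fin(2)] by (intro ennreal_leI)
qed

text \<open>First-moment form of Borel-Cantelli: the series has finite integral, so it converges
  almost everywhere and its terms tend to 0. The shift by \<open>j0\<close> discards the finitely
  many indices without a bound.\<close>

lemma AE_tendsto_0_of_summable_nn_integral:
  fixes X :: "nat \<Rightarrow> 'a \<Rightarrow> real"
  assumes "\<And>j. X j \<in> borel_measurable M" "\<And>j x. X j x \<ge> 0" "\<And>j. c j \<ge> 0" "summable c"
    and le: "\<And>j. j \<ge> j0 \<Longrightarrow> (\<integral>\<^sup>+x. ennreal (X j x) \<partial>M) \<le> ennreal (c j)"
  shows "AE x in M. (\<lambda>j. X j x) \<longlonglongrightarrow> 0"
proof -
  have [measurable]: "X j \<in> borel_measurable M" for j by (rule assms(1))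
  have "(\<integral>\<^sup>+x. (\<Sum>j. ennreal (X (j + j0) x)) \<partial>M) = (\<Sum>j. \<integral>\<^sup>+x. ennreal (X (j + j0) x) \<partial>M)"
    by (intro nn_integral_suminf) measurable
  also have "\<dots> \<le> (\<Sum>j. ennreal (c (j + j0)))"
    using le by (intro suminf_le) auto
  also have "\<dots> < \<infinity>"
    using assms(3,4) summable_ignore_initial_segment[of c j0] by (simp add: suminf_ennreal2)
  finally have "AE x in M. (\<Sum>j. ennreal (X (j + j0) x)) \<noteq> \<infinity>"
    by (intro nn_integral_PInf_AE) auto
  then show ?thesis
  proof eventually_elim
    case (elim x)
    then have "summable (\<lambda>j. X (j + j0) x)" using assms(2) by (intro summable_suminf_not_top) auto
    then show ?case by (rule LIMSEQ_offset[OF summable_LIMSEQ_zero])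
  qed
qed

section \<open>Exponential sums and discrepancy\<close>

text \<open>A supremum of reals dominates its members once the set is bounded above; every local
  discrepancy is at most 1. At \<open>N = 0\<close> the quotient is 0 by the convention for
  division.\<close>

lemma interval_discrepancy_le:
  assumes "0 \<le> a" "a < b" "b \<le> 1"
  shows "\<bar>real (card {n \<in> {1..N}. x n \<in> {a..<b}}) / real N - (b - a)\<bar> \<le> discrepancy x N"
proof -
  let ?g = "\<lambda>ab. \<bar>real (card {n \<in> {1..N}. x n \<in> {fst ab..<snd ab}}) / real N - (snd ab - fst ab)\<bar>"
  let ?I = "{(a, b). 0 \<le> a \<and> a < b \<and> b \<le> (1::real)}"
  have "bdd_above (?g ` ?I)"
  proof (rule bdd_aboveI2)
    fix ab assume ab: "ab \<in> ?I"
    let ?q = "real (card {n \<in> {1..N}. x n \<in> {fst ab..<snd ab}}) / real N"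
    have "card {n \<in> {1..N}. x n \<in> {fst ab..<snd ab}} \<le> card {1..N}" by (intro card_mono) auto
    then have "?q \<le> 1"
      by (cases "N = 0") (simp_all add: divide_simps)
    moreover have "?q \<ge> 0" by simp
    moreover have "0 \<le> snd ab - fst ab" "snd ab - fst ab \<le> 1" using ab by auto
    ultimately show "?g ab \<le> 1" by linarith
  qed
  from cSUP_upper[OF _ this, of "(a, b)"] show ?thesis
    using assms by (simp add: discrepancy_def)
qed

text \<open>Partial summation: the exponential sum is minus the integral over the unit interval of the
  derivative of \<open>\<lambda>u. cis (2 * pi * h * u)\<close> against the local discrepancy of \<open>{0..<u}\<close>.\<close>

lemma exponential_sum_le_discrepancy:
  fixes h N :: nat
  assumes x: "\<And>n. n \<in> {1..N} \<Longrightarrow> 0 \<le> x n \<and> x n < 1" and "h \<ge> 1"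
  shows "cmod (\<Sum>n=1..N. cis (2 * pi * real h * x n)) \<le> 2 * pi * real h * (real N * discrepancy x N)"
proof -
  define c where "c = 2 * pi * real h"
  define \<phi>' where "\<phi>' u = of_real c * \<i> * cis (c * u)" for u
  have c0: "c \<ge> 0" by (simp add: c_def)
  have c2: "c \<noteq> 0" using assms(2) by (simp add: c_def)
  have c1: "cis c = 1" unfolding c_def by (intro cis_multiple_2pi) simp
  have der: "((\<lambda>u. cis (c * u)) has_vector_derivative \<phi>' u) (at u within S)" for u S
    unfolding has_vector_derivative_def \<phi>'_def
    by (rule has_derivative_eq_rhs, rule derivative_intros, rule derivative_intros, rule derivative_intros)
       (auto simp: scaleR_conv_of_real fun_eq_iff)
  \<comment> \<open>The strict inequality \<open>x n < u\<close> matches the half-open counting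
    interval; it differs from \<open>u \<in> {x n..1}\<close> on the unit interval at one point
    only.\<close>
  have one: "((\<lambda>u. if x n < u then \<phi>' u else 0) has_integral (1 - cis (c * x n))) {0..1}" if "n \<in> {1..N}" for n
  proof -
    have "(\<phi>' has_integral (cis (c * 1) - cis (c * x n))) {x n..1}"
      using x[OF that] der by (intro fundamental_theorem_of_calculus) auto
    then have "((\<lambda>u. if u \<in> {x n..1} then \<phi>' u else 0) has_integral (1 - cis (c * x n))) {0..1}"
      using x[OF that] c1 by (subst has_integral_restrict) auto
    then show ?thesis
      by (rule has_integral_spike_finite[where S = "{x n}", rotated 2]) auto
  qed
  \<comment> \<open>The antiderivative comes from integration by parts. As \<open>cis c = 1\<close>,
    the value is exactly 1, so \<open>N\<close> copies of it cancel the \<open>N\<close> boundary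
    terms of \<open>one\<close> and only the exponential sum remains.\<close>
  have lin: "((\<lambda>u. of_real u * \<phi>' u) has_integral 1) {0..1}"
  proof -
    have d: "((\<lambda>u. of_real u * cis (c * u) - cis (c * u) / (of_real c * \<i>)) has_vector_derivative of_real u * \<phi>' u) (at u within S)" for u S
    proof -
      have "((\<lambda>u. of_real u * cis (c * u) - 1 / (of_real c * \<i>) * cis (c * u)) has_vector_derivative
          (of_real u * \<phi>' u + of_real 1 * cis (c * u)) - 1 / (of_real c * \<i>) * \<phi>' u) (at u within S)"
        by (intro has_vector_derivative_diff has_vector_derivative_mult has_vector_derivative_mult_right
            has_vector_derivative_of_real has_vector_derivative_id der) (simp flip: has_real_derivative_iff_has_vector_derivative)
      moreover have "1 / (of_real c * \<i>) * \<phi>' u = cis (c * u)" using c2 by (simp add: \<phi>'_def)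
      ultimately show ?thesis by simp
    qed
    have "((\<lambda>u. of_real u * \<phi>' u) has_integral
       ((of_real 1 * cis (c * 1) - cis (c * 1) / (of_real c * \<i>)) - (of_real 0 * cis (c * 0) - cis (c * 0) / (of_real c * \<i>)))) {0..1}"
      using d by (intro fundamental_theorem_of_calculus) auto
    then show ?thesis using c1 by simp
  qed
  define A where "A u = real (card {n \<in> {1..N}. x n \<in> {0..<u}})" for u
  have "((\<lambda>u. (\<Sum>n=1..N. if x n < u then \<phi>' u else 0) - of_nat N * (of_real u * \<phi>' u)) has_integral
      ((\<Sum>n=1..N. 1 - cis (c * x n)) - of_nat N * 1)) {0..1}"
    using one lin by (intro has_integral_diff has_integral_sum has_integral_mult_right) auto
  moreover have "(\<Sum>n=1..N. if x n < u then \<phi>' u else 0) - of_nat N * (of_real u * \<phi>' u) = of_real (A u - real N * u) * \<phi>' u"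
    for u
  proof -
    have "(\<Sum>n=1..N. if x n < u then \<phi>' u else 0) = (\<Sum>n\<in>{n \<in> {1..N}. x n \<in> {0..<u}}. \<phi>' u)"
      using x by (intro sum.mono_neutral_cong_right) auto
    then show ?thesis by (simp add: A_def algebra_simps)
  qed
  ultimately have hi: "((\<lambda>u. of_real (A u - real N * u) * \<phi>' u) has_integral (- (\<Sum>n=1..N. cis (c * x n)))) {0..1}"
    by (simp add: sum_subtractf)
  have bound: "norm (of_real (A u - real N * u) * \<phi>' u) \<le> c * (real N * discrepancy x N)"
    if "u \<in> {0..1} - {0}" for u
  proof -
    have "\<bar>A u - real N * u\<bar> \<le> real N * discrepancy x N"
    proof (cases "N = 0")
      case False
      have "\<bar>A u / real N - u\<bar> \<le> discrepancy x N"
        using interval_discrepancy_le[of 0 u N x] that by (simp add: A_def)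
      then have "real N * \<bar>A u / real N - u\<bar> \<le> real N * discrepancy x N" by (intro mult_left_mono) auto
      moreover have "real N * \<bar>A u / real N - u\<bar> = \<bar>real N * (A u / real N - u)\<bar>" by (simp add: abs_mult)
      ultimately show ?thesis using False by (simp add: right_diff_distrib)
    qed (simp add: A_def)
    then show ?thesis using c0 by (simp add: norm_mult \<phi>'_def mult.commute mult_left_mono del: of_real_diff)
  qed
  let ?g = "\<lambda>u. if u = 0 then 0 else of_real (A u - real N * u) * \<phi>' u"
  have "norm (- (\<Sum>n=1..N. cis (c * x n))) \<le> c * (real N * discrepancy x N) * Henstock_Kurzweil_Integration.content (cbox 0 (1::real))"
  proof (rule has_integral_bound[of _ ?g])
    show nonneg: "0 \<le> c * (real N * discrepancy x N)"
      by (rule order_trans[OF norm_ge_zero bound[of 1]]) simp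
    show "(?g has_integral (- (\<Sum>n=1..N. cis (c * x n)))) (cbox 0 1)"
      unfolding box_real by (rule has_integral_spike_finite[OF _ _ hi, of "{0}"]) auto
    show "norm (?g u) \<le> c * (real N * discrepancy x N)" if "u \<in> cbox 0 1" for u
      using that bound[of u] nonneg by (cases "u = 0") (simp_all only: box_real if_True if_False norm_zero Diff_iff singleton_iff not_False_eq_True simp_thms)
  qed
  then show ?thesis by (simp add: c_def norm_minus_cancel)
qed

text \<open>Since \<open>h\<close> is an integer, the discarded integer parts contribute full turns.
  Dilating \<open>\<alpha>\<close> by \<open>h\<close> becomes frequency \<open>h\<close> on one
  fixed sequence, so a single discrepancy controls all dilates.\<close>

lemma exponential_sum_frac:
  "(\<Sum>n=1..N. cis (2 * pi * real h * frac (of_int (f n) * \<alpha>))) = (\<Sum>n=1..N. cis (2 * pi * of_int (f n) * (real h * \<alpha>)))"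
proof (rule sum.cong)
  fix n
  let ?y = "of_int (f n) * \<alpha>"
  have "2 * pi * of_int (f n) * (real h * \<alpha>) = 2 * pi * real h * frac ?y + 2 * pi * of_int (int h * \<lfloor>?y\<rfloor>)"
    by (simp add: frac_def algebra_simps)
  then show "cis (2 * pi * real h * frac ?y) = cis (2 * pi * of_int (f n) * (real h * \<alpha>))"
    by (simp only: cis_mult[symmetric] cis_multiple_2pi[OF Ints_of_int] mult_1_right)
qed simp

section \<open>Averages over dilations\<close>

text \<open>One extra power of \<open>N\<close> absorbs both the factor 2 and the finitely many
  values below \<open>n0\<close>, which \<open>c\<close> dominates.\<close>

lemma values_le_power:
  fixes f :: "nat \<Rightarrow> int"
  assumes "\<exists>t::nat. \<exists>n0. \<forall>n\<ge>n0. \<bar>f n\<bar> \<le> int n ^ t"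
  obtains s N1 where "\<And>N x. N \<ge> N1 \<Longrightarrow> x \<in> {1..N} \<Longrightarrow> 2 * \<bar>f x\<bar> \<le> int N ^ s"
proof -
  obtain t n0 where t: "\<And>n. n \<ge> n0 \<Longrightarrow> \<bar>f n\<bar> \<le> int n ^ t" using assms by blast
  define c where "c = nat (\<Sum>n<n0. \<bar>f n\<bar>)"
  have "2 * \<bar>f x\<bar> \<le> int N ^ (t + 1)" if N: "N \<ge> 2 * c + 2" and x: "x \<in> {1..N}" for N x
  proof (cases "x \<ge> n0")
    case True
    have "2 * \<bar>f x\<bar> \<le> int N * int x ^ t" using t[OF True] N by (intro mult_mono) auto
    also have "\<dots> \<le> int N * int N ^ t" using x by (intro mult_left_mono power_mono) auto
    finally show ?thesis by simp
  next
    case False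
    then have "\<bar>f x\<bar> \<le> (\<Sum>n<n0. \<bar>f n\<bar>)" by (intro member_le_sum) auto
    then have "\<bar>f x\<bar> \<le> int c" by (simp add: c_def)
    then have "2 * \<bar>f x\<bar> \<le> int N ^ 1" using N by simp
    also have "\<dots> \<le> int N ^ (t + 1)" using N by (intro power_increasing) auto
    finally show ?thesis .
  qed
  then show ?thesis using that by blast
qed

lemma dilated_mean_square_tendsto:
  fixes f :: "nat \<Rightarrow> int" and q :: nat and m :: int
  assumes growth: "\<exists>t::nat. \<exists>n0. \<forall>n\<ge>n0. \<bar>f n\<bar> \<le> int n ^ t"
    and reps: "sum_reps_small f \<or> diff_reps_small f" and "q \<ge> 1"
  shows "AE \<alpha> in lborel. \<alpha> \<in> {of_int m..of_int m + 1} \<longrightarrow>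
    (\<lambda>j. (\<Sum>h=1..2 ^ j. (cmod (\<Sum>n=1..2 ^ (q * j). cis (2 * pi * of_int (f n) * (real h * \<alpha>))))\<^sup>2)
      / (2 ^ j * real (diff_count f (2 ^ (q * j)) 0))) \<longlonglongrightarrow> 1"
proof -
  obtain s N1 where s: "\<And>N x. N \<ge> N1 \<Longrightarrow> x \<in> {1..N} \<Longrightarrow> 2 * \<bar>f x\<bar> \<le> int N ^ s"
    by (rule values_le_power[OF growth]) (erule that)
  \<comment> \<open>With \<open>N = 2 ^ (q * j)\<close>, integers up to \<open>N ^ (s + 1)\<close>
    have \<open>\<delta>\<close>-th power at most \<open>2 powr (j / 4)\<close>. The divisor bound
    and the energy bound each cost this much, in total \<open>2 powr (j / 2)\<close> against the
    saving \<open>2 ^ j\<close>.\<close>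
  define \<delta> where "\<delta> = 1 / (4 * real q * (real s + 1))"
  have \<delta>: "\<delta> > 0" using assms(3) by (simp add: \<delta>_def)
  obtain Ce where Ce: "Ce \<ge> 0" "\<And>N B. B \<ge> 1 \<Longrightarrow> (\<And>x. x \<in> {1..N} \<Longrightarrow> 2 * \<bar>f x\<bar> \<le> B) \<Longrightarrow>
      real (\<Sum>k=-B..B. (diff_count f N k)\<^sup>2) \<le> Ce * real_of_int B powr \<delta> * (real (diff_count f N 0))\<^sup>2"
    by (rule additive_energy_le[OF \<delta> reps]) (erule that[rotated])
  obtain Cd where Cd: "Cd \<ge> 0" "\<And>m::nat. m > 0 \<Longrightarrow> real (card {d. d dvd m}) \<le> Cd * real m powr \<delta>"
    by (rule card_divisors_le_powr[OF \<delta>]) (erule that[rotated])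
  define N :: "nat \<Rightarrow> nat" where "N j = 2 ^ (q * j)" for j
  define E where "E j = real (diff_count f (N j) 0)" for j
  define S where "S j \<alpha> = (\<Sum>h=1..2 ^ j. (cmod (\<Sum>n=1..N j. cis (2 * pi * of_int (f n) * (real h * \<alpha>))))\<^sup>2)" for j :: nat and \<alpha>
  define X where "X j \<alpha> = (S j \<alpha> / (2 ^ j * E j) - 1)\<^sup>2 * indicator {of_int m..of_int m + 1} \<alpha>" for j \<alpha>
  have E0: "E j > 0" for j
  proof -
    have "0 < N j" by (simp add: N_def)
    also have "\<dots> \<le> diff_count f (N j) 0" by (rule diff_count_0_ge)
    finally show ?thesis by (simp add: E_def)
  qed
  have powr_le: "real b powr \<delta> \<le> 2 powr (real j / 4)" if "b \<le> N j ^ (s + 1)" for b j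
  proof -
    have "real b powr \<delta> \<le> real (N j ^ (s + 1)) powr \<delta>"
      using that \<delta> by (intro powr_mono2) (auto simp only: of_nat_le_iff of_nat_0_le_iff less_imp_le)
    also have "real (N j ^ (s + 1)) = 2 powr (real q * real j * (real s + 1))"
    proof -
      have "real (N j ^ (s + 1)) = 2 ^ (q * j * (s + 1))" by (simp only: N_def of_nat_power of_nat_numeral power_mult)
      also have "\<dots> = 2 powr real (q * j * (s + 1))" by (simp only: powr_realpow)
      finally show ?thesis by (simp only: of_nat_mult of_nat_add of_nat_1)
    qed
    also have "\<dots> powr \<delta> = 2 powr (real j / 4)"
      using assms(3) by (simp add: powr_powr \<delta>_def add_eq_0_iff)
    finally show ?thesis .
  qed
  have le: "(\<integral>\<^sup>+\<alpha>. ennreal (X j \<alpha>) \<partial>lborel) \<le> ennreal (Cd * Ce * (2 powr (- 1 / 2)) ^ j)" if j: "j \<ge> N1" for j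
  proof -
    define B where "B = int (N j) ^ s"
    define K where "K = {-B..B} - {0}"
    \<comment> \<open>Removing the constant term \<open>E j\<close> from each of the
      \<open>2 ^ j\<close> dilated squares leaves \<open>G\<close>, the deviation of
      \<open>S j\<close> from its mean.\<close>
    define G where "G \<alpha> = (\<Sum>h=1..2 ^ j. \<Sum>k\<in>K. of_real (real (diff_count f (N j) k)) * cis (2 * pi * of_int k * (real h * \<alpha>)))" for \<alpha>
    have "N1 \<le> j" by (rule j)
    also have "j \<le> 2 ^ j" by (rule less_imp_le[OF less_exp])
    also have jN: "(2::nat) ^ j \<le> N j" using assms(3) unfolding N_def by (intro power_increasing) auto
    finally have fB: "\<And>x. x \<in> {1..N j} \<Longrightarrow> 2 * \<bar>f x\<bar> \<le> B" unfolding B_def by (rule s)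
    have B1: "B \<ge> 1" unfolding B_def N_def by (simp add: one_le_power)
    have finK: "finite K" "0 \<notin> K" by (auto simp: K_def)
    have XG: "X j \<alpha> = (cmod (G \<alpha>))\<^sup>2 * (1 / (2 ^ j * E j)\<^sup>2) * indicator {of_int m..of_int m + 1} \<alpha>" for \<alpha>
    proof -
      have remove: "(\<Sum>k=-B..B. g k) = g 0 + (\<Sum>k\<in>K. g k)" for g :: "int \<Rightarrow> complex"
        unfolding K_def using B1 by (intro sum.remove) auto
      have "of_real ((cmod (\<Sum>n=1..N j. cis (2 * pi * of_int (f n) * \<beta>)))\<^sup>2) =
          of_real (E j) + (\<Sum>k\<in>K. of_real (real (diff_count f (N j) k)) * cis (2 * pi * of_int k * \<beta>))" for \<beta>
        by (subst norm_sq_exponential_sum[of _ _ B]) (use fB in \<open>auto simp: remove E_def\<close>)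
      then have "of_real (S j \<alpha>) = (\<Sum>h=(1::nat)..2 ^ j. of_real (E j) +
          (\<Sum>k\<in>K. of_real (real (diff_count f (N j) k)) * cis (2 * pi * of_int k * (real h * \<alpha>))))"
        unfolding S_def of_real_sum by simp
      also have "\<dots> = of_real (2 ^ j * E j) + G \<alpha>"
        unfolding sum.distrib G_def by simp
      finally have "G \<alpha> = of_real (S j \<alpha> - 2 ^ j * E j)" by simp
      then have "(cmod (G \<alpha>))\<^sup>2 = (S j \<alpha> - 2 ^ j * E j)\<^sup>2" by (simp only: norm_of_real power2_abs)
      moreover have "S j \<alpha> / (2 ^ j * E j) - 1 = (S j \<alpha> - 2 ^ j * E j) * (1 / (2 ^ j * E j))"
        using E0[of j] by (simp add: field_simps)
      ultimately show ?thesis by (simp add: X_def power_mult_distrib power_divide)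
    qed
    \<comment> \<open>Here \<open>h \<le> 2 ^ j \<le> N j\<close> and
      \<open>\<bar>k\<bar> \<le> B\<close>, so the frequency stays within the range
      \<open>N j ^ (s + 1)\<close> for which \<open>\<delta>\<close> was tuned.\<close>
    have D: "real (card {d. d dvd nat \<bar>int h * k\<bar>}) \<le> Cd * 2 powr (real j / 4)"
      if "h \<in> {1..2 ^ j}" "k \<in> K" for h k
    proof -
      have "\<bar>int h * k\<bar> \<le> int (N j) * B" unfolding abs_mult
      proof (rule mult_mono)
        show "\<bar>int h\<bar> \<le> int (N j)" using that(1) jN by simp
        show "\<bar>k\<bar> \<le> B" using that(2) by (auto simp: K_def)
      qed auto
      also have "\<dots> = int (N j ^ (s + 1))" by (simp add: B_def)
      finally have "nat \<bar>int h * k\<bar> \<le> N j ^ (s + 1)" by (simp only: nat_le_iff)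
      then have "Cd * real (nat \<bar>int h * k\<bar>) powr \<delta> \<le> Cd * 2 powr (real j / 4)"
        using Cd(1) by (intro mult_left_mono powr_le)
      moreover have "nat \<bar>int h * k\<bar> > 0" using that by (auto simp: K_def)
      ultimately show ?thesis using Cd(2) order_trans by blast
    qed
    have energy: "(\<Sum>k\<in>K. (real (diff_count f (N j) k))\<^sup>2) \<le> Ce * 2 powr (real j / 4) * (E j)\<^sup>2"
    proof -
      have "(\<Sum>k\<in>K. (real (diff_count f (N j) k))\<^sup>2) \<le> (\<Sum>k=-B..B. (real (diff_count f (N j) k))\<^sup>2)"
        by (intro sum_mono2) (auto simp: K_def)
      also have "\<dots> = real (\<Sum>k=-B..B. (diff_count f (N j) k)\<^sup>2)" by simp
      also have "\<dots> \<le> Ce * real_of_int B powr \<delta> * (E j)\<^sup>2" unfolding E_def by (intro Ce(2) B1 fB)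
      also have "\<dots> \<le> Ce * 2 powr (real j / 4) * (E j)\<^sup>2"
      proof (intro mult_right_mono mult_left_mono)
        have "N j ^ s \<le> N j ^ (s + 1)" by (intro power_increasing) (auto simp: N_def)
        from powr_le[OF this] show "real_of_int B powr \<delta> \<le> 2 powr (real j / 4)" by (simp add: B_def)
      qed (use Ce(1) in auto)
      finally show ?thesis .
    qed
    have "(\<integral>\<^sup>+\<alpha>. ennreal (X j \<alpha>) \<partial>lborel) = (\<integral>\<^sup>+\<alpha>. ennreal (1 / (2 ^ j * E j)\<^sup>2) *
        (ennreal ((cmod (G \<alpha>))\<^sup>2) * indicator {of_int m..of_int m + 1} \<alpha>) \<partial>lborel)"
      by (intro nn_integral_cong) (auto simp: XG indicator_def mult.commute simp flip: ennreal_mult)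
    also have "\<dots> = ennreal (1 / (2 ^ j * E j)\<^sup>2) *
        (\<integral>\<^sup>+\<alpha>. ennreal ((cmod (G \<alpha>))\<^sup>2) * indicator {of_int m..of_int m + 1} \<alpha> \<partial>lborel)"
      by (intro nn_integral_cmult) (simp add: G_def cis_conv_exp)
    also have "\<dots> \<le> ennreal (1 / (2 ^ j * E j)\<^sup>2) *
        ennreal (Cd * 2 powr (real j / 4) * (real (2 ^ j) * (\<Sum>k\<in>K. (real (diff_count f (N j) k))\<^sup>2)))"
      unfolding G_def by (intro mult_left_mono nn_integral_dilated_sums_le finK D) auto
    also have "\<dots> = ennreal (1 / (2 ^ j * E j)\<^sup>2 *
        (Cd * 2 powr (real j / 4) * (real (2 ^ j) * (\<Sum>k\<in>K. (real (diff_count f (N j) k))\<^sup>2))))"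
      using Cd(1) by (intro ennreal_mult[symmetric]) (auto intro!: mult_nonneg_nonneg sum_nonneg)
    also have "\<dots> \<le> ennreal (1 / (2 ^ j * E j)\<^sup>2 *
        (Cd * 2 powr (real j / 4) * (real (2 ^ j) * (Ce * 2 powr (real j / 4) * (E j)\<^sup>2))))"
      using Cd(1) energy by (intro ennreal_leI mult_left_mono) auto
    also have "1 / (2 ^ j * E j)\<^sup>2 *
        (Cd * 2 powr (real j / 4) * (real (2 ^ j) * (Ce * 2 powr (real j / 4) * (E j)\<^sup>2))) =
        Cd * Ce * (2 powr (real j / 4) * 2 powr (real j / 4) / 2 ^ j)"
      using E0[of j] by (simp add: field_simps power2_eq_square)
    also have "2 powr (real j / 4) * 2 powr (real j / 4) / 2 ^ j = (2 powr (- 1 / 2)) ^ j"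
    proof -
      have "2 powr (real j / 4) * 2 powr (real j / 4) / 2 ^ j = 2 powr (real j / 4 + real j / 4 - real j)"
        by (simp only: powr_add powr_diff powr_realpow zero_less_numeral)
      also have "\<dots> = 2 powr (- 1 / 2 * real j)" by (simp add: field_simps)
      finally show ?thesis by (simp add: powr_powr flip: powr_realpow)
    qed
    finally show ?thesis .
  qed
  have summ: "summable (\<lambda>j. Cd * Ce * (2 powr (- 1 / 2)) ^ j)"
  proof (intro summable_mult summable_geometric)
    have "(2::real) powr (- 1 / 2) < 2 powr 0" by (rule powr_less_mono) auto
    then show "norm ((2::real) powr (- 1 / 2)) < 1" by simp
  qed
  have "AE \<alpha> in lborel. (\<lambda>j. X j \<alpha>) \<longlonglongrightarrow> 0"
  proof (rule AE_tendsto_0_of_summable_nn_integral[OF _ _ _ summ le])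
    show "X j \<in> borel_measurable lborel" for j
      unfolding X_def S_def by (simp add: cis_conv_exp)
    show "X j x \<ge> 0" for j x by (simp add: X_def)
    show "0 \<le> Cd * Ce * (2 powr (- 1 / 2)) ^ j" for j using Cd(1) Ce(1) by simp
  qed
  then show ?thesis
  proof eventually_elim
    case (elim \<alpha>)
    show ?case
    proof
      assume "\<alpha> \<in> {of_int m..of_int m + 1}"
      then have "(\<lambda>j. (S j \<alpha> / (2 ^ j * E j) - 1)\<^sup>2) \<longlonglongrightarrow> 0" using elim by (simp add: X_def)
      then have "(\<lambda>j. S j \<alpha> / (2 ^ j * E j) - 1) \<longlonglongrightarrow> 0" by (simp add: power_tendsto_0_iff)
      then have "(\<lambda>j. S j \<alpha> / (2 ^ j * E j)) \<longlonglongrightarrow> 1" by (simp add: LIM_zero_iff)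
      then show "(\<lambda>j. (\<Sum>h=1..2 ^ j. (cmod (\<Sum>n=1..2 ^ (q * j). cis (2 * pi * of_int (f n) * (real h * \<alpha>))))\<^sup>2)
          / (2 ^ j * real (diff_count f (2 ^ (q * j)) 0))) \<longlonglongrightarrow> 1"
        by (simp only: S_def E_def N_def)
    qed
  qed
qed

text \<open>If no \<open>(F h)\<^sup>2\<close> exceeded \<open>N / 4\<close>, the quotient would be
  at most 1/4, because its denominator uses \<open>diff_count f N 0 \<ge> N\<close>. The frequency
  \<open>h\<close> so found feeds the discrepancy inequality.\<close>

lemma discrepancy_ge_of_dilated_mean_square:
  fixes f :: "nat \<Rightarrow> int" and q j :: nat
  assumes "q \<ge> 1" "j \<ge> 4" and mean: "(\<Sum>h=1..2 ^ j. (cmod (\<Sum>n=1..2 ^ (q * j). cis (2 * pi * of_int (f n) * (real h * \<alpha>))))\<^sup>2)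
      / (2 ^ j * real (diff_count f (2 ^ (q * j)) 0)) > 1 / 4"
  shows "real (2 ^ (q * j)) * discrepancy (\<lambda>n. frac (of_int (f n) * \<alpha>)) (2 ^ (q * j))
      \<ge> real (2 ^ (q * j)) powr (1 / 2 - 2 / real q)"
proof -
  define N :: nat where "N = 2 ^ (q * j)"
  define F where "F h = cmod (\<Sum>n=1..N. cis (2 * pi * of_int (f n) * (real h * \<alpha>)))" for h :: nat
  define D where "D = real N * discrepancy (\<lambda>n. frac (of_int (f n) * \<alpha>)) N"
  have N0: "real N > 0" by (simp add: N_def)
  have EN: "real N \<le> real (diff_count f N 0)" by (simp only: of_nat_le_iff diff_count_0_ge)
  have "\<exists>h\<in>{1..2 ^ j}. (F h)\<^sup>2 > real N / 4"
  proof (rule ccontr)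
    assume "\<not> ?thesis"
    then have "(\<Sum>h=1..2 ^ j. (F h)\<^sup>2) \<le> (\<Sum>h=1..(2::nat) ^ j. real N / 4)"
      by (intro sum_mono) (auto simp: not_less)
    also have "\<dots> = 2 ^ j * (real N / 4)" by simp
    also have "\<dots> \<le> 2 ^ j * (real (diff_count f N 0) / 4)" using EN by simp
    finally have "(\<Sum>h=1..2 ^ j. (F h)\<^sup>2) / (2 ^ j * real (diff_count f N 0)) \<le> 1 / 4"
      using N0 EN by (simp add: divide_simps)
    then show False using mean by (simp add: F_def N_def)
  qed
  then obtain h where h: "h \<in> {1..2 ^ j}" "(F h)\<^sup>2 > real N / 4" by blast
  have "sqrt (real N) / 2 = sqrt (real N / 4)" by (simp add: real_sqrt_divide)
  also have "\<dots> \<le> F h" using h(2) by (intro real_le_lsqrt) (auto simp: F_def)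
  also have "F h \<le> 2 * pi * real h * D"
    unfolding F_def D_def exponential_sum_frac[symmetric]
    using h(1) by (intro exponential_sum_le_discrepancy) (auto simp: frac_lt_1)
  finally have lower: "sqrt (real N) / 2 \<le> 2 * pi * real h * D" .
  \<comment> \<open>Nonnegativity is read off from \<open>lower\<close>; it permits enlarging the
    factors in front of \<open>D\<close>.\<close>
  have D0: "D \<ge> 0"
  proof (rule ccontr)
    assume "\<not> D \<ge> 0"
    then have "2 * pi * real h * D \<le> 0" by (intro mult_nonneg_nonpos) auto
    with lower have "sqrt (real N) \<le> 0" by linarith
    with N0 show False by simp
  qed
  have "sqrt (real N) / 2 \<le> 8 * 2 ^ j * D"
  proof -
    have "2 * pi * real h * D \<le> 8 * 2 ^ j * D"
    proof (intro mult_right_mono mult_mono)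
      show "2 * pi \<le> 8" using pi_less_4 by simp
      show "real h \<le> 2 ^ j" using h(1) by (metis atLeastAtMost_iff of_nat_le_iff of_nat_numeral of_nat_power)
    qed (use D0 in auto)
    with lower show ?thesis by linarith
  qed
  \<comment> \<open>One factor \<open>2 ^ j\<close> has paid for \<open>h\<close>; a second one
    swallows the constant 16. Their product is \<open>N powr (2 / q)\<close>.\<close>
  moreover have "(16::real) \<le> 2 ^ j" using power_increasing[OF assms(2), of "2::real"] by simp
  then have "16 * (2 ^ j * D) \<le> 2 ^ j * (2 ^ j * D)" using D0 by (intro mult_right_mono) auto
  ultimately have "sqrt (real N) \<le> 2 ^ j * (2 ^ j * D)" by linarith
  then have "sqrt (real N) / (2 ^ j * 2 ^ j) \<le> D" by (simp add: divide_simps mult_ac)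
  moreover have "real N powr (1 / 2 - 2 / real q) = sqrt (real N) / (2 ^ j * 2 ^ j)"
  proof -
    have "real N = 2 powr real (q * j)" unfolding N_def by (simp add: powr_realpow del: of_nat_mult)
    then have "real N powr (2 / real q) = 2 powr (real j + real j)"
      using assms(1) by (simp add: powr_powr field_simps)
    also have "\<dots> = 2 ^ j * 2 ^ j" by (simp only: powr_add powr_realpow)
    finally have "real N powr (2 / real q) = 2 ^ j * 2 ^ j" .
    then show ?thesis using N0 by (simp add: powr_diff powr_half_sqrt)
  qed
  ultimately show ?thesis by (simp add: D_def N_def)
qed

theorem theorem2:
  fixes f :: "nat \<Rightarrow> int"
  assumes growth: "\<exists>t::nat. \<exists>n0. \<forall>n\<ge>n0. \<bar>f n\<bar> \<le> int n ^ t"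
    and reps: "sum_reps_small f \<or> diff_reps_small f"
  shows "AE \<alpha> in lborel. \<forall>\<epsilon>>0. \<exists>\<^sub>\<infinity>N.
           real N * discrepancy (\<lambda>n. frac (real_of_int (f n) * \<alpha>)) N \<ge> real N powr (1/2 - \<epsilon>)"
proof -
  let ?Q = "\<lambda>q \<alpha> j. (\<Sum>h=1..2 ^ j. (cmod (\<Sum>n=1..2 ^ (q * j). cis (2 * pi * of_int (f n) * (real h * \<alpha>))))\<^sup>2)
      / (2 ^ j * real (diff_count f (2 ^ (q * j)) 0))"
  have "AE \<alpha> in lborel. \<alpha> \<in> {of_int m..of_int m + 1} \<longrightarrow> ?Q (Suc p) \<alpha> \<longlonglongrightarrow> 1" for p m
    by (rule dilated_mean_square_tendsto[OF growth reps]) simp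
  \<comment> \<open>Both \<open>p\<close> and \<open>m\<close> range over countable sets, so one
    null set serves every \<open>q\<close> and every unit interval; off it, each of the uncountably
    many \<open>\<epsilon>\<close> is handled by choosing
    \<open>q \<ge> 2 / \<epsilon>\<close>.\<close>
  then have "AE \<alpha> in lborel. \<forall>p m. \<alpha> \<in> {of_int m..of_int m + 1} \<longrightarrow> ?Q (Suc p) \<alpha> \<longlonglongrightarrow> 1"
    unfolding AE_all_countable by blast
  then show ?thesis
  proof eventually_elim
    case (elim \<alpha>)
    show ?case
    proof (intro allI impI)
      fix \<epsilon> :: real assume "\<epsilon> > 0"
      define p where "p = nat \<lceil>2 / \<epsilon>\<rceil>"
      define q where "q = Suc p"
      have "2 / \<epsilon> \<le> real q" unfolding q_def p_def by linarith
      then have q: "2 / real q \<le> \<epsilon>" using \<open>\<epsilon> > 0\<close> by (simp add: q_def field_simps)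
      have "\<alpha> \<in> {of_int \<lfloor>\<alpha>\<rfloor>..of_int \<lfloor>\<alpha>\<rfloor> + 1}" by (simp add: less_imp_le)
      then have "?Q q \<alpha> \<longlonglongrightarrow> 1" using elim unfolding q_def by blast
      then have "\<forall>\<^sub>F j in sequentially. ?Q q \<alpha> j > 1 / 4" by (rule order_tendstoD) simp
      then have "\<forall>\<^sub>F j in sequentially. j \<ge> 4 \<and> ?Q q \<alpha> j > 1 / 4"
        using eventually_ge_at_top[of 4] by eventually_elim simp
      then obtain J where J: "\<And>j. j \<ge> J \<Longrightarrow> j \<ge> 4 \<and> ?Q q \<alpha> j > 1 / 4"
        unfolding eventually_sequentially by blast
      show "\<exists>\<^sub>\<infinity>N. real N * discrepancy (\<lambda>n. frac (real_of_int (f n) * \<alpha>)) N \<ge> real N powr (1/2 - \<epsilon>)"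
        unfolding INFM_nat_le
      proof
        fix b :: nat
        \<comment> \<open>\<open>J\<close> secures the large mean, and \<open>b\<close> forces
          \<open>N \<ge> 2 ^ j > b\<close>.\<close>
        define j where "j = max J b"
        define N :: nat where "N = 2 ^ (q * j)"
        have "b \<le> j" by (simp add: j_def)
        also have "j < 2 ^ j" by (rule less_exp)
        also have "(2::nat) ^ j \<le> N" unfolding N_def by (intro power_increasing) (auto simp: q_def)
        finally have "b \<le> N" by simp
        have "real N powr (1 / 2 - \<epsilon>) \<le> real N powr (1 / 2 - 2 / real q)"
          using q by (intro powr_mono) (auto simp: N_def)
        also have "\<dots> \<le> real N * discrepancy (\<lambda>n. frac (real_of_int (f n) * \<alpha>)) N"
          unfolding N_def using J[of j] by (intro discrepancy_ge_of_dilated_mean_square) (auto simp: q_def j_def)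
        finally show "\<exists>N\<ge>b. real N powr (1 / 2 - \<epsilon>) \<le> real N * discrepancy (\<lambda>n. frac (real_of_int (f n) * \<alpha>)) N"
          using \<open>b \<le> N\<close> by blast
      qed
    qed
  qed
qed

end
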